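(* Fix any constant deletion rate $0<\delta<1$. There is a suitable absolute constant $c_0>0$ such that any $c_0 n^{1/5}/(\log n)^{2/5}$-local SQ algorithm for worst-case trace reconstruction (of $n$-bit strings) must have tolerance $\tau_0 < \exp\bigl(-\Omega(n^{1/5}/(\log n)^{2/5})\bigr)$.
   Context: Trace reconstruction: fix a deletion rate $\delta\in(0,1)$. For a source string $x=(x_0,\dots,x_{n-1})\in\{0,1\}^n$, a random trace $\mathbf y\sim \mathrm{Del}_\delta(x)$ is obtained by deleting each bit of $x$ independently with probability $\delta$ and concatenating the surviving bits. Each trace is padded with a suffix of zeros to length $n$ (equivalently $x$ is padded by infinitely many zeros), so $\mathbf y_i$ is defined for every $i$. A statistical query (SQ) oracle for $x$ takes a query function $q:\{0,1\}^n\to[-1,1]$ and a tolerance $\tau\in(0,1)$ and returns some value $\widehat P_q$ with $|\widehat P_q - \mathbb E_{\mathbf y\sim \mathrm{Del}_\delta(x)}[q(\mathbf y)]|\le\tau$. A query $q$ is $\ell$-local if $q(y)=q'(y_i,y_{i+1},\dots,y_{i+\ell-1})$ for some index $i$ and some $q':\{0,1\}^\ell\to[-1,1]$. An $\ell$-local SQ algorithm with tolerance $\tau_0$ is an algorithm (possibly adaptive) all of whose oracle calls use $\ell$-local query functions and tolerance at least $\tau_0$. It solves worst-case trace reconstruction if for every $x\in\{0,1\}^n$ and every valid sequence of oracle responses it outputs $x$. Here $\log$ is base 2. *)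

theory Defs
  imports "HOL-Probability.Probability"
begin

definition del_channel :: "real \<Rightarrow> bool list \<Rightarrow> bool list pmf" where
  "del_channel \<delta> x =
     map_pmf (\<lambda>deleted. nths x {i. \<not> deleted i})
       (Pi_pmf {..<length x} False (\<lambda>_. bernoulli_pmf \<delta>))"

definition pad_zeros :: "nat \<Rightarrow> bool list \<Rightarrow> bool list" where
  "pad_zeros n y = y @ replicate (n - length y) False"

definition padded_trace :: "real \<Rightarrow> bool list \<Rightarrow> bool list pmf" where
  "padded_trace \<delta> x = map_pmf (pad_zeros (length x)) (del_channel \<delta> x)"

text \<open>
  Positions beyond the end of \<open>y\<close> read as zero, so a window may start at any index.
\<close>

definition window :: "nat \<Rightarrow> nat \<Rightarrow> bool list \<Rightarrow> bool list" where
  "window i l y = map (\<lambda>j. j < length y \<and> y ! j) [i..<i + l]"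

definition local_query :: "nat \<Rightarrow> nat \<Rightarrow> (bool list \<Rightarrow> real) \<Rightarrow> bool" where
  "local_query n l q \<longleftrightarrow>
     (\<exists>i q'. (\<forall>w. length w = l \<longrightarrow> q' w \<in> {-1..1}) \<and>
             (\<forall>y. length y = n \<longrightarrow> q y = q' (window i l y)))"

text \<open>
  An adaptive algorithm is a decision tree: it either halts with an output, or asks a query
  with a tolerance and continues depending on the real number returned by the oracle.
  The tree may be infinitely deep overall, but each of its branches is finite.
\<close>

datatype sq_algorithm =
    Output "bool list"
  | Query "bool list \<Rightarrow> real" real "real \<Rightarrow> sq_algorithm"

primrec local_sq_algorithm :: "nat \<Rightarrow> nat \<Rightarrow> real \<Rightarrow> sq_algorithm \<Rightarrow> bool" where
  "local_sq_algorithm n l \<tau>\<^sub>0 (Output z) \<longleftrightarrow> True"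
| "local_sq_algorithm n l \<tau>\<^sub>0 (Query q \<tau> k) \<longleftrightarrow>
     local_query n l q \<and> \<tau> \<in> {0<..<1} \<and> \<tau>\<^sub>0 \<le> \<tau> \<and> (\<forall>r. local_sq_algorithm n l \<tau>\<^sub>0 (k r))"

text \<open>
  \<open>sq_run \<delta> x A z\<close>: some valid sequence of responses of the oracle for \<open>x\<close> makes \<open>A\<close> output \<open>z\<close>.
  As branches are finite and a valid response always exists, every valid
  sequence of responses leads to an output.
\<close>

inductive sq_run :: "real \<Rightarrow> bool list \<Rightarrow> sq_algorithm \<Rightarrow> bool list \<Rightarrow> bool" for \<delta> x where
  run_output: "sq_run \<delta> x (Output z) z"
| run_query: "\<bar>r - measure_pmf.expectation (padded_trace \<delta> x) q\<bar> \<le> \<tau> \<Longrightarrow> sq_run \<delta> x (k r) z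
          \<Longrightarrow> sq_run \<delta> x (Query q \<tau> k) z"

definition solves_trace_reconstruction :: "real \<Rightarrow> nat \<Rightarrow> sq_algorithm \<Rightarrow> bool" where
  "solves_trace_reconstruction \<delta> n A \<longleftrightarrow>
     (\<forall>x z. length x = n \<longrightarrow> sq_run \<delta> x A z \<longrightarrow> z = x)"

end

theory Submission
  imports Defs "HOL-Library.More_List" "HOL-Complex_Analysis.Cauchy_Integral_Formula"
    "HOL-Real_Asymp.Real_Asymp"
begin

text \<open>
  Let \<open>\<Lambda> = n powr (1/5) / log 2 n powr (2/5)\<close> and \<open>p = 1 - \<delta>\<close>. Take strings whose ones sit at
  positions \<open>s + G t\<close> with \<open>t < N\<close>, where \<open>s = n div 2\<close> and \<open>G\<close> is about \<open>4 \<Lambda> / p\<close>. A window of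
  length at most \<open>\<Lambda>\<close> of the trace then contains two ones with probability at most \<open>n exp (- \<Lambda>)\<close>, so
  up to that error every local query is an affine function of the probabilities \<open>Pr[y\<^sub>j = 1]\<close>.
  These are the coefficients of \<open>p \<Sum>\<^sub>m x\<^sub>m w ^ m\<close>, where \<open>w = \<delta> + p z\<close>, and Cauchy's inequality
  bounds their differences by the supremum over the circle \<open>\<bar>z\<bar> = 1\<close>.

  If \<open>N > D\<^sup>2 log 2 n\<close>, the pigeonhole principle gives two such strings whose sums of \<open>G t choose r\<close>
  agree for all \<open>r < D\<close>. Expanding \<open>w ^ (G t)\<close> in powers of \<open>w - 1\<close>, the difference of the
  generating functions is at most \<open>2 N \<bar>w\<bar> ^ s exp (e \<bar>w - 1\<bar> G N - D)\<close>, and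
  \<open>\<bar>w\<bar> ^ s \<le> exp (- \<delta> s \<bar>w - 1\<bar>\<^sup>2 / (2 p))\<close>. With \<open>D\<close> about \<open>a \<Lambda>\<close> for a small constant \<open>a\<close>
  this is at most \<open>2 N exp (- D / 2)\<close>, because \<open>(G N)\<^sup>2\<close> is of order \<open>a\<^sup>4 \<Lambda> n\<close>, which is small
  against \<open>D n\<close>. An oracle answering with the midpoint of the two expectations cannot separate the
  two strings.
\<close>

abbreviation trace_expectation ::
    "real \<Rightarrow> bool list \<Rightarrow> (bool list \<Rightarrow> 'a :: {banach, second_countable_topology}) \<Rightarrow> 'a" where
  "trace_expectation \<delta> x \<equiv> measure_pmf.expectation (del_channel \<delta> x)"

abbreviation trace_prob :: "real \<Rightarrow> bool list \<Rightarrow> (bool list \<Rightarrow> bool) \<Rightarrow> real" where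
  "trace_prob \<delta> x P \<equiv> trace_expectation \<delta> x (\<lambda>y. of_bool (P y))"

abbreviation query_mean :: "real \<Rightarrow> bool list \<Rightarrow> (bool list \<Rightarrow> real) \<Rightarrow> real" where
  "query_mean \<delta> x \<equiv> measure_pmf.expectation (padded_trace \<delta> x)"

abbreviation bit_at :: "bool list \<Rightarrow> nat \<Rightarrow> bool" where
  "bit_at \<equiv> nth_default False"

lemma window_eq_bit_at: "window i l y = map (\<lambda>k. bit_at y (i + k)) [0..<l]"
  by (auto simp: window_def nth_default_def intro: nth_equalityI)

lemma length_window [simp]: "length (window i l y) = l"
  and nth_window [simp]: "k < l \<Longrightarrow> window i l y ! k = bit_at y (i + k)"
  by (simp_all add: window_eq_bit_at)

lemma window_pad_zeros: "window i l (pad_zeros n y) = window i l y"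
  by (simp add: window_eq_bit_at pad_zeros_def)

lemma del_channel_Nil [simp]: "del_channel \<delta> [] = return_pmf []"
  by (simp add: del_channel_def)

lemma del_channel_Cons:
  "del_channel \<delta> (b # x) =
     bind_pmf (bernoulli_pmf \<delta>) (\<lambda>d. map_pmf (\<lambda>y. if d then y else b # y) (del_channel \<delta> x))"
proof -
  let ?B = "\<lambda>_::nat. bernoulli_pmf \<delta>"
  have shift: "Pi_pmf {..<length x} False ?B =
      map_pmf (\<lambda>g. g \<circ> Suc) (Pi_pmf (Suc ` {..<length x}) False ?B)"
    by (rule Pi_pmf_bij_betw) (auto simp: bij_betw_def)
  have "del_channel \<delta> (b # x) = bind_pmf (bernoulli_pmf \<delta>) (\<lambda>d.
      map_pmf (\<lambda>f. nths (b # x) {i. \<not> (f(0 := d)) i}) (Pi_pmf (Suc ` {..<length x}) False ?B))"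
    unfolding del_channel_def
    by (simp add: lessThan_Suc_eq_insert_0 Pi_pmf_insert' map_bind_pmf map_pmf_def
        bind_assoc_pmf bind_return_pmf)
  also have "\<dots> = bind_pmf (bernoulli_pmf \<delta>) (\<lambda>d.
      map_pmf (\<lambda>y. if d then y else b # y) (del_channel \<delta> x))"
    unfolding del_channel_def shift
    by (auto simp: map_pmf_comp nths_Cons o_def intro!: bind_pmf_cong map_pmf_cong)
  finally show ?thesis .
qed

lemma finite_set_pmf_del_channel [simp]: "finite (set_pmf (del_channel \<delta> x))"
  by (induction x) (auto simp: del_channel_Cons)

lemma integrable_del_channel [simp]:
  fixes f :: "bool list \<Rightarrow> 'a :: {banach, second_countable_topology}"
  shows "integrable (measure_pmf (del_channel \<delta> x)) f"
  by (simp add: integrable_measure_pmf_finite)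

lemma length_trace_le: "y \<in> set_pmf (del_channel \<delta> x) \<Longrightarrow> length y \<le> length x"
  by (auto simp: del_channel_def length_nths intro: card_mono[of "{..<length x}", simplified])

lemma trace_expectation_cong:
  fixes f g :: "bool list \<Rightarrow> 'a :: {banach, second_countable_topology}"
  assumes "\<And>y. length y \<le> length x \<Longrightarrow> f y = g y"
  shows "trace_expectation \<delta> x f = trace_expectation \<delta> x g"
  by (rule integral_cong_AE) (use assms length_trace_le in \<open>auto intro!: AE_pmfI\<close>)

lemma trace_expectation_mono:
  fixes f g :: "bool list \<Rightarrow> real"
  shows "(\<And>y. f y \<le> g y) \<Longrightarrow> trace_expectation \<delta> x f \<le> trace_expectation \<delta> x g"
  by (intro integral_mono) auto

lemma trace_prob_le_1: "trace_prob \<delta> x P \<le> 1"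
  using trace_expectation_mono[of "\<lambda>y. of_bool (P y)" "\<lambda>_. 1" \<delta> x] by simp

lemma trace_expectation_Cons:
  fixes f :: "bool list \<Rightarrow> 'a :: {banach, second_countable_topology}"
  assumes "0 \<le> \<delta>" "\<delta> \<le> 1"
  shows "trace_expectation \<delta> (b # x) f =
    \<delta> *\<^sub>R trace_expectation \<delta> x f + (1 - \<delta>) *\<^sub>R trace_expectation \<delta> x (\<lambda>y. f (b # y))"
  unfolding del_channel_Cons using assms
  by (subst pmf_expectation_bind[of UNIV]) (auto simp: UNIV_bool)

lemma query_mean_local_query:
  assumes "\<And>y. length y = length x \<Longrightarrow> q y = f (window i l y)"
  shows "query_mean \<delta> x q = trace_expectation \<delta> x (\<lambda>y. f (window i l y))"
proof -
  have "query_mean \<delta> x q = trace_expectation \<delta> x (\<lambda>y. q (pad_zeros (length x) y))"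
    by (simp add: padded_trace_def)
  also have "\<dots> = trace_expectation \<delta> x (\<lambda>y. f (window i l y))"
  proof (rule trace_expectation_cong)
    fix y :: "bool list" assume "length y \<le> length x"
    hence "length (pad_zeros (length x) y) = length x" by (simp add: pad_zeros_def)
    thus "q (pad_zeros (length x) y) = f (window i l y)"
      by (simp add: assms window_pad_zeros)
  qed
  finally show ?thesis .
qed

section \<open>One-bit statistics\<close>

definition bit_prob :: "real \<Rightarrow> bool list \<Rightarrow> nat \<Rightarrow> real" where
  "bit_prob \<delta> x j = trace_prob \<delta> x (\<lambda>y. bit_at y j)"

lemma bit_prob_eq_0:
  assumes "length x \<le> j"
  shows "bit_prob \<delta> x j = 0"
proof -
  have "bit_prob \<delta> x j = trace_expectation \<delta> x (\<lambda>y. 0)"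
    unfolding bit_prob_def
    by (rule trace_expectation_cong) (use assms in \<open>simp add: nth_default_beyond\<close>)
  thus ?thesis by simp
qed

lemma horner_sum_of_bool_eq_sum_bit_at:
  fixes z :: "'a :: comm_semiring_1"
  assumes "length y \<le> n"
  shows "horner_sum of_bool z y = (\<Sum>j<n. of_bool (bit_at y j) * z ^ j)"
proof -
  have "horner_sum of_bool z y = (\<Sum>j<length y. of_bool (bit_at y j) * z ^ j)"
    by (auto simp: horner_sum_eq_sum nth_default_nth lessThan_atLeast0 intro: sum.cong)
  also have "\<dots> = (\<Sum>j<n. of_bool (bit_at y j) * z ^ j)"
    by (rule sum.mono_neutral_left) (use assms in \<open>auto simp: nth_default_beyond\<close>)
  finally show ?thesis .
qed

definition deletion_map :: "real \<Rightarrow> complex \<Rightarrow> complex" where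
  "deletion_map \<delta> z = of_real \<delta> + of_real (1 - \<delta>) * z"

lemma trace_expectation_horner_sum:
  fixes z :: complex
  assumes "0 \<le> \<delta>" "\<delta> \<le> 1"
  shows "trace_expectation \<delta> x (horner_sum of_bool z) =
    of_real (1 - \<delta>) * horner_sum of_bool (deletion_map \<delta> z) x"
proof (induction x)
  case Nil
  show ?case by simp
next
  case (Cons b x)
  let ?E = "trace_expectation \<delta> x (horner_sum of_bool z)"
  have "trace_expectation \<delta> (b # x) (horner_sum of_bool z) =
      of_real \<delta> * ?E + of_real (1 - \<delta>) * (of_bool b + z * ?E)"
    using assms by (simp add: trace_expectation_Cons scaleR_conv_of_real)
  also have "\<dots> = of_real (1 - \<delta>) * of_bool b + deletion_map \<delta> z * ?E"
    by (simp add: deletion_map_def algebra_simps)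
  finally show ?case by (simp add: Cons.IH algebra_simps)
qed

lemma sum_bit_prob_eq_horner_sum:
  fixes z :: complex
  assumes "0 \<le> \<delta>" "\<delta> \<le> 1"
  shows "(\<Sum>j<length x. of_real (bit_prob \<delta> x j) * z ^ j) =
    of_real (1 - \<delta>) * horner_sum of_bool (deletion_map \<delta> z) x"
proof -
  have of_real_of_bool: "complex_of_real (of_bool P) = of_bool P" for P
    by simp
  have bit_prob: "of_real (bit_prob \<delta> x j) =
      trace_expectation \<delta> x (\<lambda>y. of_bool (bit_at y j) :: complex)" for j
    by (simp add: bit_prob_def flip: of_real_of_bool)
  have "(\<Sum>j<length x. of_real (bit_prob \<delta> x j) * z ^ j) =
      trace_expectation \<delta> x (\<lambda>y. \<Sum>j<length x. of_bool (bit_at y j) * z ^ j)"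
    unfolding bit_prob
    by (subst Bochner_Integration.integral_sum) simp_all
  also have "\<dots> = trace_expectation \<delta> x (horner_sum of_bool z)"
    by (rule trace_expectation_cong) (simp add: horner_sum_of_bool_eq_sum_bit_at)
  finally show ?thesis by (simp add: trace_expectation_horner_sum[OF assms])
qed

lemma norm_coeff_le_sup_circle:
  fixes p :: "complex poly"
  assumes "r > 0" and bound: "\<And>z. norm z = r \<Longrightarrow> norm (poly p z) \<le> B"
  shows "norm (coeff p j) \<le> B / r ^ j"
proof -
  have eval: "eval_fps (fps_of_poly p) = poly p"
    by (simp add: fun_eq_iff)
  have "fact j * norm (coeff p j) = norm ((deriv ^^ j) (poly p) 0)"
    using fps_nth_conv_deriv[of "fps_of_poly p" j] by (simp add: eval norm_divide)
  also have "\<dots> \<le> fact j * B / r ^ j"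
    by (rule Cauchy_inequality) (simp_all add: assms holomorphic_intros continuous_intros)
  finally have "fact j * norm (coeff p j) \<le> fact j * (B / r ^ j)" by simp
  thus ?thesis by (rule mult_left_le_imp_le) simp
qed

section \<open>Windows containing two ones\<close>

definition crowded :: "nat \<Rightarrow> bool list \<Rightarrow> bool" where
  "crowded l y \<longleftrightarrow> (\<exists>i j. i < j \<and> j < i + l \<and> bit_at y i \<and> bit_at y j)"

definition spaced :: "nat \<Rightarrow> bool list \<Rightarrow> bool" where
  "spaced g x \<longleftrightarrow> (\<forall>i j. i < j \<longrightarrow> bit_at x i \<longrightarrow> bit_at x j \<longrightarrow> i + g < j)"

lemma crowded_Nil [simp]: "\<not> crowded l []"
  by (simp add: crowded_def)

lemma crowded_ConsE:
  assumes "crowded l (b # y)"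
  obtains "crowded l y" | j where "b" "j < l" "bit_at y j"
proof -
  obtain i j where ij: "i < j" "j < i + l" "bit_at (b # y) i" "bit_at (b # y) j"
    using assms by (auto simp: crowded_def)
  then obtain j' where j': "j = Suc j'" by (cases j) auto
  show thesis
  proof (cases i)
    case 0
    thus thesis using ij j' that(2)[of j'] by simp
  next
    case (Suc i')
    hence "i' < j'" "j' < i' + l" "bit_at y i'" "bit_at y j'"
      using ij j' by simp_all
    thus thesis using that(1) unfolding crowded_def by blast
  qed
qed

lemma spaced_ConsD:
  assumes "spaced g (b # x)"
  shows "spaced g x" and "b \<Longrightarrow> i < g \<Longrightarrow> \<not> bit_at x i"
proof -
  have "i + g < j" if "i < j" "bit_at x i" "bit_at x j" for i j
    using assms[unfolded spaced_def, rule_format, of "Suc i" "Suc j"] that by simp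
  thus "spaced g x" by (simp add: spaced_def)
  show "\<not> bit_at x i" if b "i < g"
    using assms[unfolded spaced_def, rule_format, of 0 "Suc i"] that by auto
qed

lemma trace_prob_early_one_le:
  assumes \<delta>: "0 \<le> \<delta>" "\<delta> \<le> 1" and "\<And>i. i < g \<Longrightarrow> \<not> bit_at x i"
  shows "trace_prob \<delta> x (\<lambda>y. \<exists>j<l. bit_at y j) \<le> 2 ^ l * ((1 + \<delta>) / 2) ^ g"
  using assms(3)
proof (induction x arbitrary: g l)
  case Nil
  show ?case using \<delta> by simp
next
  case (Cons b x)
  let ?P = "\<lambda>x l. trace_prob \<delta> x (\<lambda>y. \<exists>j<l. bit_at y j)"
  show ?case
  proof (cases g)
    case 0
    have "?P (b # x) l \<le> 1" by (rule trace_prob_le_1)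
    also have "\<dots> \<le> 2 ^ l" by simp
    finally show ?thesis using 0 by simp
  next
    case (Suc g')
    have b: "\<not> b" using Cons.prems[of 0] Suc by simp
    have x: "\<not> bit_at x i" if "i < g'" for i
      using Cons.prems[of "Suc i"] Suc that by simp
    show ?thesis
    proof (cases l)
      case 0
      thus ?thesis using \<delta> by simp
    next
      case l: (Suc l')
      have "(\<exists>j<l. bit_at (b # y) j) \<longleftrightarrow> (\<exists>j<l'. bit_at y j)" for y
        using b by (simp add: l Ex_less_Suc2)
      hence "?P (b # x) l = \<delta> * ?P x l + (1 - \<delta>) * ?P x l'"
        using \<delta> by (simp add: trace_expectation_Cons)
      also have "\<dots> \<le> \<delta> * (2 ^ l * ((1 + \<delta>) / 2) ^ g') + (1 - \<delta>) * (2 ^ l' * ((1 + \<delta>) / 2) ^ g')"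
        using \<delta> x by (intro add_mono mult_left_mono Cons.IH) auto
      also have "\<dots> = 2 ^ l * ((1 + \<delta>) / 2) ^ g"
        by (simp add: l Suc algebra_simps)
      finally show ?thesis .
    qed
  qed
qed

lemma trace_prob_crowded_le:
  assumes \<delta>: "0 \<le> \<delta>" "\<delta> \<le> 1" and "spaced g x"
  shows "trace_prob \<delta> x (crowded l) \<le> length x * (2 ^ l * ((1 + \<delta>) / 2) ^ g)"
  using assms(3)
proof (induction x)
  case Nil
  show ?case by simp
next
  case (Cons b x)
  let ?E = "2 ^ l * ((1 + \<delta>) / 2) ^ g"
  let ?crowded = "trace_prob \<delta> x (crowded l)"
  let ?early = "trace_prob \<delta> x (\<lambda>y. b \<and> (\<exists>j<l. bit_at y j))"
  have E_nonneg: "?E \<ge> 0" using \<delta> by simp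
  have early_le: "?early \<le> ?E"
  proof (cases b)
    case True
    thus ?thesis
      using trace_prob_early_one_le[OF \<delta>, of g x l] spaced_ConsD(2)[OF Cons.prems] by simp
  qed (use E_nonneg in simp)
  have "trace_prob \<delta> x (\<lambda>y. crowded l (b # y)) \<le>
      trace_expectation \<delta> x (\<lambda>y. of_bool (crowded l y) + of_bool (b \<and> (\<exists>j<l. bit_at y j)))"
    by (rule trace_expectation_mono) (auto elim: crowded_ConsE)
  also have "\<dots> = ?crowded + ?early" by simp
  also have "\<dots> \<le> ?crowded + ?E" using early_le by simp
  finally have "\<delta> * ?crowded + (1 - \<delta>) * trace_prob \<delta> x (\<lambda>y. crowded l (b # y)) \<le>
      \<delta> * ?crowded + (1 - \<delta>) * (?crowded + ?E)"
    using \<delta> by (intro add_left_mono mult_left_mono) auto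
  also have "\<dots> = ?crowded + (1 - \<delta>) * ?E" by (simp add: algebra_simps)
  also have "\<dots> \<le> length x * ?E + 1 * ?E"
    using \<delta> E_nonneg Cons.IH spaced_ConsD(1)[OF Cons.prems] by (intro add_mono mult_right_mono) auto
  finally show ?case
    using \<delta> by (simp add: trace_expectation_Cons algebra_simps)
qed

text \<open>The affine function of the bits that agrees with \<open>f\<close> on the words with at most one \<open>1\<close>.\<close>

definition linearization :: "nat \<Rightarrow> (bool list \<Rightarrow> real) \<Rightarrow> (nat \<Rightarrow> real) \<Rightarrow> real" where
  "linearization l f v = f (replicate l False) +
     (\<Sum>k<l. (f ((replicate l False)[k := True]) - f (replicate l False)) * v k)"

lemma linearization_zero [simp]: "linearization l f (\<lambda>k. 0) = f (replicate l False)"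
  by (simp add: linearization_def)

lemma linearization_diff_le:
  assumes f: "\<And>w. length w = l \<Longrightarrow> f w \<in> {-1..1}" and v: "\<And>k. k < l \<Longrightarrow> \<bar>v k - v' k\<bar> \<le> \<eta>"
  shows "\<bar>linearization l f v - linearization l f v'\<bar> \<le> 2 * real l * \<eta>"
proof -
  let ?z = "replicate l False"
  have coeff: "\<bar>f (?z[k := True]) - f ?z\<bar> \<le> 2" for k
    using f[of "?z[k := True]"] f[of ?z] by (simp add: abs_le_iff)
  have "\<bar>linearization l f v - linearization l f v'\<bar> =
      \<bar>\<Sum>k<l. (f (?z[k := True]) - f ?z) * (v k - v' k)\<bar>"
    by (simp add: linearization_def sum_subtractf right_diff_distrib)
  also have "\<dots> \<le> (\<Sum>k<l. 2 * \<eta>)"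
    by (intro order.trans[OF sum_abs] sum_mono) (auto simp: abs_mult intro!: mult_mono coeff v)
  finally show ?thesis by simp
qed

lemma linearization_of_bool_eq:
  assumes w: "length w = l" and unique: "\<And>j k. j < l \<Longrightarrow> k < l \<Longrightarrow> w ! j \<Longrightarrow> w ! k \<Longrightarrow> j = k"
  shows "linearization l f (\<lambda>k. of_bool (w ! k)) = f w"
proof (cases "\<exists>k<l. w ! k")
  case False
  hence "w = replicate l False" using w by (intro nth_equalityI) auto
  thus ?thesis by (simp add: linearization_def)
next
  case True
  then obtain k where k: "k < l" "w ! k" by blast
  have w_eq: "w = (replicate l False)[k := True]"
    using w k unique by (intro nth_equalityI) (auto simp: nth_list_update)
  let ?z = "replicate l False"
  have "(f (?z[j := True]) - f ?z) * of_bool (w ! j) = (if j = k then f w - f ?z else 0)"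
    if "j < l" for j
  proof (cases "j = k")
    case True
    thus ?thesis using k(2) arg_cong[OF w_eq, of f] by simp
  next
    case False
    hence "\<not> w ! j" using unique k that by blast
    thus ?thesis using False by simp
  qed
  hence "(\<Sum>j<l. (f (?z[j := True]) - f ?z) * of_bool (w ! j)) =
      (\<Sum>j<l. if j = k then f w - f ?z else 0)"
    by (intro sum.cong) auto
  thus ?thesis using k(1) by (simp add: linearization_def)
qed

lemma window_linearization_error:
  assumes f: "\<And>w. length w = l \<Longrightarrow> f w \<in> {-1..1}"
  shows "\<bar>f (window i l y) - linearization l f (\<lambda>k. of_bool (bit_at y (i + k)))\<bar>
    \<le> 2 * (1 + real l) * of_bool (crowded l y)"
proof (cases "crowded l y")
  case True
  have "\<bar>linearization l f (\<lambda>k. of_bool (bit_at y (i + k))) - linearization l f (\<lambda>k. 0)\<bar>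
      \<le> 2 * real l * 1"
    using f by (rule linearization_diff_le) simp_all
  thus ?thesis
    using f[of "window i l y"] f[of "replicate l False"] True by (simp add: abs_le_iff)
next
  case False
  have "j = k" if "bit_at y (i + j)" "bit_at y (i + k)" "j < l" "k < l" for j k
  proof (rule ccontr)
    assume "j \<noteq> k"
    hence "crowded l y" unfolding crowded_def
      by (intro exI[of _ "i + min j k"] exI[of _ "i + max j k"])
         (use that in \<open>auto simp: min_def max_def\<close>)
    thus False using False by simp
  qed
  hence "linearization l f (\<lambda>k. of_bool (window i l y ! k)) = f (window i l y)"
    by (intro linearization_of_bool_eq) auto
  moreover have "linearization l f (\<lambda>k. of_bool (window i l y ! k)) =
      linearization l f (\<lambda>k. of_bool (bit_at y (i + k)))"
    by (simp add: linearization_def)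
  ultimately show ?thesis by simp
qed

lemma trace_expectation_linearization:
  "trace_expectation \<delta> x (\<lambda>y. linearization l f (\<lambda>k. of_bool (bit_at y (i + k)))) =
    linearization l f (\<lambda>k. bit_prob \<delta> x (i + k))"
  unfolding linearization_def bit_prob_def
  by (subst Bochner_Integration.integral_add)
     (simp_all add: Bochner_Integration.integral_sum del: sum_mult_of_bool_eq)

lemma window_expectation_linearization_error:
  assumes "\<And>w. length w = l \<Longrightarrow> f w \<in> {-1..1}"
  shows "\<bar>trace_expectation \<delta> x (\<lambda>y. f (window i l y)) -
      linearization l f (\<lambda>k. bit_prob \<delta> x (i + k))\<bar>
    \<le> 2 * (1 + real l) * trace_prob \<delta> x (crowded l)"
proof -
  let ?L = "\<lambda>y. linearization l f (\<lambda>k. of_bool (bit_at y (i + k)))"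
  have "\<bar>trace_expectation \<delta> x (\<lambda>y. f (window i l y)) -
        linearization l f (\<lambda>k. bit_prob \<delta> x (i + k))\<bar> =
      \<bar>trace_expectation \<delta> x (\<lambda>y. f (window i l y) - ?L y)\<bar>"
    by (simp flip: trace_expectation_linearization)
  also have "\<dots> \<le> trace_expectation \<delta> x (\<lambda>y. \<bar>f (window i l y) - ?L y\<bar>)"
    by (rule integral_abs_bound)
  also have "\<dots> \<le> trace_expectation \<delta> x (\<lambda>y. 2 * (1 + real l) * of_bool (crowded l y))"
    by (rule trace_expectation_mono) (rule window_linearization_error[OF assms])
  finally show ?thesis by simp
qed

section \<open>Indistinguishable strings\<close>

definition indistinguishable :: "real \<Rightarrow> nat \<Rightarrow> nat \<Rightarrow> real \<Rightarrow> bool list \<Rightarrow> bool list \<Rightarrow> bool" where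
  "indistinguishable \<delta> n l \<tau> x x' \<longleftrightarrow>
     (\<forall>q. local_query n l q \<longrightarrow> \<bar>query_mean \<delta> x q - query_mean \<delta> x' q\<bar> \<le> 2 * \<tau>)"

lemma indistinguishable_mono:
  "indistinguishable \<delta> n l \<tau> x x' \<Longrightarrow> \<tau> \<le> \<tau>' \<Longrightarrow> indistinguishable \<delta> n l \<tau>' x x'"
  unfolding indistinguishable_def by force

lemma indistinguishable_if_bit_probs_close:
  assumes len: "length x = n" "length x' = n"
    and crowd: "trace_prob \<delta> x (crowded l) \<le> \<epsilon>" "trace_prob \<delta> x' (crowded l) \<le> \<epsilon>"
    and bits: "\<And>j. \<bar>bit_prob \<delta> x j - bit_prob \<delta> x' j\<bar> \<le> \<eta>"
  shows "indistinguishable \<delta> n l (2 * (1 + real l) * \<epsilon> + real l * \<eta>) x x'"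
  unfolding indistinguishable_def
proof (intro allI impI)
  fix q assume "local_query n l q"
  then obtain i f where f: "\<And>w. length w = l \<Longrightarrow> f w \<in> {-1..1}"
    and q: "\<And>y. length y = n \<Longrightarrow> q y = f (window i l y)"
    unfolding local_query_def by blast
  let ?L = "\<lambda>u. linearization l f (\<lambda>k. bit_prob \<delta> u (i + k))"
  have approx: "\<bar>query_mean \<delta> u q - ?L u\<bar> \<le> 2 * (1 + real l) * \<epsilon>"
    if "length u = n" "trace_prob \<delta> u (crowded l) \<le> \<epsilon>" for u
  proof -
    have "query_mean \<delta> u q = trace_expectation \<delta> u (\<lambda>y. f (window i l y))"
      using that q by (intro query_mean_local_query) simp
    hence "\<bar>query_mean \<delta> u q - ?L u\<bar> \<le> 2 * (1 + real l) * trace_prob \<delta> u (crowded l)"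
      using window_expectation_linearization_error[OF f] by simp
    also have "\<dots> \<le> 2 * (1 + real l) * \<epsilon>"
      using that by (intro mult_left_mono) auto
    finally show ?thesis .
  qed
  have "\<bar>?L x - ?L x'\<bar> \<le> 2 * real l * \<eta>"
    by (intro linearization_diff_le f bits)
  with approx[OF len(1) crowd(1)] approx[OF len(2) crowd(2)]
  show "\<bar>query_mean \<delta> x q - query_mean \<delta> x' q\<bar> \<le> 2 * (2 * (1 + real l) * \<epsilon> + real l * \<eta>)"
    by (simp add: abs_le_iff algebra_simps)
qed

lemma indistinguishable_imp_common_run:
  assumes "indistinguishable \<delta> n l \<tau>\<^sub>0 x x'" and "local_sq_algorithm n l \<tau>\<^sub>0 A"
  obtains z where "sq_run \<delta> x A z" "sq_run \<delta> x' A z"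
proof -
  have "\<exists>z. sq_run \<delta> x A z \<and> sq_run \<delta> x' A z"
    using assms(2)
  proof (induction A)
    case (Output z)
    show ?case by (blast intro: run_output)
  next
    case (Query q \<tau> k)
    define r where "r = (query_mean \<delta> x q + query_mean \<delta> x' q) / 2"
    have q: "local_query n l q" "\<tau>\<^sub>0 \<le> \<tau>" "local_sq_algorithm n l \<tau>\<^sub>0 (k r)"
      using Query.prems by auto
    obtain z where z: "sq_run \<delta> x (k r) z" "sq_run \<delta> x' (k r) z"
      using Query.IH[OF rangeI q(3)] by blast
    have "\<bar>query_mean \<delta> x q - query_mean \<delta> x' q\<bar> \<le> 2 * \<tau>"
      using assms(1) q(1,2) unfolding indistinguishable_def by force
    hence "\<bar>r - query_mean \<delta> x q\<bar> \<le> \<tau>" "\<bar>r - query_mean \<delta> x' q\<bar> \<le> \<tau>"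
      by (auto simp: r_def abs_le_iff field_simps)
    with z show ?case by (blast intro: run_query)
  qed
  with that show thesis by blast
qed

definition admits_indistinguishable_pair :: "real \<Rightarrow> real \<Rightarrow> real \<Rightarrow> nat \<Rightarrow> bool" where
  "admits_indistinguishable_pair \<delta> \<Lambda> \<tau> n \<longleftrightarrow>
     (\<exists>x x'. length x = n \<and> length x' = n \<and> x \<noteq> x' \<and>
       (\<forall>l. real l \<le> \<Lambda> \<longrightarrow> indistinguishable \<delta> n l \<tau> x x'))"

lemma tolerance_less_if_solves:
  assumes pair: "admits_indistinguishable_pair \<delta> \<Lambda> \<tau> n" and l: "real l \<le> \<Lambda>"
    and A: "local_sq_algorithm n l \<tau>\<^sub>0 A" and solves: "solves_trace_reconstruction \<delta> n A"
  shows "\<tau>\<^sub>0 < \<tau>"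
proof (rule ccontr)
  assume "\<not> \<tau>\<^sub>0 < \<tau>"
  obtain x x' where x: "length x = n" "length x' = n" "x \<noteq> x'"
    and "indistinguishable \<delta> n l \<tau> x x'"
    using pair l unfolding admits_indistinguishable_pair_def by blast
  hence "indistinguishable \<delta> n l \<tau>\<^sub>0 x x'"
    using \<open>\<not> \<tau>\<^sub>0 < \<tau>\<close> by (auto elim: indistinguishable_mono)
  then obtain z where "sq_run \<delta> x A z" "sq_run \<delta> x' A z"
    using A by (rule indistinguishable_imp_common_run)
  thus False
    using x solves unfolding solves_trace_reconstruction_def by metis
qed

section \<open>Sets with equal binomial moments\<close>

definition same_binomial_moments :: "nat \<Rightarrow> nat set \<Rightarrow> nat set \<Rightarrow> bool" where
  "same_binomial_moments D S S' \<longleftrightarrow> (\<forall>r<D. (\<Sum>m\<in>S. m choose r) = (\<Sum>m\<in>S'. m choose r))"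

lemma equal_subset_sums_exist:
  fixes f :: "'b \<Rightarrow> 'a \<Rightarrow> nat"
  assumes "finite P" "finite I" and bound: "\<And>r. r \<in> I \<Longrightarrow> (\<Sum>m\<in>P. f r m) < B"
    and card: "B ^ card I < 2 ^ card P"
  obtains T T' where "T \<subseteq> P" "T' \<subseteq> P" "T \<noteq> T'" "\<And>r. r \<in> I \<Longrightarrow> (\<Sum>m\<in>T. f r m) = (\<Sum>m\<in>T'. f r m)"
proof -
  define F where "F T = (\<lambda>r\<in>I. \<Sum>m\<in>T. f r m)" for T
  have "F ` Pow P \<subseteq> I \<rightarrow>\<^sub>E {..<B}"
  proof (intro image_subsetI PiE_I)
    fix T r assume "T \<in> Pow P" and r: "r \<in> I"
    hence "(\<Sum>m\<in>T. f r m) \<le> (\<Sum>m\<in>P. f r m)"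
      using \<open>finite P\<close> by (intro sum_mono2) auto
    also have "\<dots> < B" using r by (rule bound)
    finally show "F T r \<in> {..<B}" using r by (simp add: F_def)
  qed (simp add: F_def)
  hence "card (F ` Pow P) \<le> card (I \<rightarrow>\<^sub>E {..<B})"
    using \<open>finite I\<close> by (intro card_mono finite_PiE) auto
  also have "\<dots> < card (Pow P)"
    using assms by (simp add: card_PiE card_Pow)
  finally have "\<not> inj_on F (Pow P)" by (rule pigeonhole)
  then obtain T T' where T: "T \<subseteq> P" "T' \<subseteq> P" "T \<noteq> T'" "F T = F T'"
    by (auto simp: inj_on_def)
  have "(\<Sum>m\<in>T. f r m) = (\<Sum>m\<in>T'. f r m)" if "r \<in> I" for r
    using fun_cong[OF T(4), of r] that by (simp add: F_def)
  with T(1-3) show thesis by (rule that)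
qed

lemma same_binomial_moments_exist:
  assumes P: "P \<subseteq> {..n}" "card P < n" and card: "n ^ (D * D) < 2 ^ card P"
  obtains T T' where "T \<subseteq> P" "T' \<subseteq> P" "T \<noteq> T'" "same_binomial_moments D T T'"
proof -
  have "finite P" using P(1) by (rule finite_subset) simp
  have "(\<Sum>m\<in>P. m choose r) < n ^ D" if r: "r \<in> {..<D}" for r
  proof -
    have "m choose r \<le> n ^ (D - 1)" if "m \<in> P" for m
    proof (cases "r \<le> m")
      case True
      have "m choose r \<le> m ^ r" using True by (rule binomial_le_pow)
      also have "\<dots> \<le> n ^ r" using that P(1) by (intro power_mono) auto
      also have "\<dots> \<le> n ^ (D - 1)" using r P(2) by (intro power_increasing) auto
      finally show ?thesis .
    qed (simp add: binomial_eq_0)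
    hence "(\<Sum>m\<in>P. m choose r) \<le> card P * n ^ (D - 1)"
      using sum_mono[of P "\<lambda>m. m choose r" "\<lambda>_. n ^ (D - 1)"] by simp
    also have "\<dots> < n * n ^ (D - 1)" using P(2) by simp
    also have "\<dots> = n ^ D" using r by (cases D) auto
    finally show ?thesis .
  qed
  moreover have "(n ^ D) ^ card {..<D} < 2 ^ card P"
    using card by (simp flip: power_mult)
  ultimately obtain T T' where "T \<subseteq> P" "T' \<subseteq> P" "T \<noteq> T'"
    and "\<And>r. r \<in> {..<D} \<Longrightarrow> (\<Sum>m\<in>T. m choose r) = (\<Sum>m\<in>T'. m choose r)"
    using equal_subset_sums_exist[of P "{..<D}" "\<lambda>r m. m choose r" "n ^ D"] \<open>finite P\<close>
    by (metis finite_lessThan)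
  with that show thesis by (simp add: same_binomial_moments_def)
qed

text \<open>As in Chernoff's bound, the tail is dominated by inserting the weights \<open>exp (r - D) \<ge> 1\<close>.\<close>

lemma norm_binomial_tail_le:
  fixes h :: "'a :: real_normed_field"
  shows "norm (\<Sum>r=D..m. of_nat (m choose r) * h ^ r) \<le> exp (exp 1 * norm h * m - D)"
proof -
  have "norm (\<Sum>r=D..m. of_nat (m choose r) * h ^ r) \<le> (\<Sum>r=D..m. real (m choose r) * norm h ^ r)"
    by (rule order.trans[OF norm_sum]) (simp add: norm_mult norm_power)
  also have "\<dots> \<le> (\<Sum>r=D..m. real (m choose r) * norm h ^ r * exp (real r - real D))"
  proof (rule sum_mono)
    fix r assume "r \<in> {D..m}"
    hence "1 \<le> exp (real r - real D)" by simp
    thus "real (m choose r) * norm h ^ r \<le> real (m choose r) * norm h ^ r * exp (real r - real D)"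
      using mult_left_mono[of 1 "exp (real r - real D)" "real (m choose r) * norm h ^ r"] by simp
  qed
  also have "\<dots> \<le> (\<Sum>r\<le>m. real (m choose r) * norm h ^ r * exp (real r - real D))"
    by (intro sum_mono2) auto
  also have "\<dots> = exp (- real D) * (\<Sum>r\<le>m. real (m choose r) * (exp 1 * norm h) ^ r * 1 ^ (m - r))"
    unfolding sum_distrib_left
    by (intro sum.cong)
       (auto simp: power_mult_distrib exp_diff exp_minus field_simps simp flip: exp_of_nat_mult)
  also have "\<dots> = exp (- real D) * (exp 1 * norm h + 1) ^ m"
    by (simp only: binomial_ring)
  also have "\<dots> \<le> exp (- real D) * exp (exp 1 * norm h) ^ m"
    by (intro mult_left_mono power_mono) (auto simp: add.commute)
  also have "\<dots> = exp (exp 1 * norm h * m - D)"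
    by (simp add: mult_ac flip: exp_of_nat_mult exp_add)
  finally show ?thesis .
qed

lemma power_eq_binomial_head_plus_tail:
  fixes w :: "'a :: comm_ring_1"
  shows "w ^ m = (\<Sum>r<D. of_nat (m choose r) * (w - 1) ^ r) +
    (\<Sum>r=D..m. of_nat (m choose r) * (w - 1) ^ r)"
proof -
  have "w ^ m = (\<Sum>r\<le>m. of_nat (m choose r) * (w - 1) ^ r)"
    using binomial_ring[of "w - 1" 1 m] by simp
  also have "\<dots> = (\<Sum>r\<in>{..<D} \<union> {D..m}. of_nat (m choose r) * (w - 1) ^ r)"
    by (intro sum.mono_neutral_left) (auto simp: binomial_eq_0)
  finally show ?thesis by (subst (asm) sum.union_disjoint) auto
qed

lemma norm_power_sum_diff_le:
  fixes w :: "'a :: real_normed_field"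
  assumes S: "S \<subseteq> {..H}" "S' \<subseteq> {..H}" and same: "same_binomial_moments D S S'"
  shows "norm ((\<Sum>m\<in>S. w ^ m) - (\<Sum>m\<in>S'. w ^ m)) \<le>
    (card S + card S') * exp (exp 1 * norm (w - 1) * H - D)"
proof -
  let ?hd = "\<lambda>m. \<Sum>r<D. of_nat (m choose r) * (w - 1) ^ r"
  let ?tl = "\<lambda>m. \<Sum>r=D..m. of_nat (m choose r) * (w - 1) ^ r"
  let ?B = "exp (exp 1 * norm (w - 1) * H - D)"
  have head: "(\<Sum>m\<in>T. ?hd m) = (\<Sum>r<D. of_nat (\<Sum>m\<in>T. m choose r) * (w - 1) ^ r)" for T
    by (subst sum.swap) (simp add: sum_distrib_right)
  have head_eq: "(\<Sum>m\<in>S. ?hd m) = (\<Sum>m\<in>S'. ?hd m)"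
    unfolding head using same
    by (intro sum.cong refl) (simp only: same_binomial_moments_def lessThan_iff)
  have "norm (?tl m) \<le> ?B" if "m \<le> H" for m
  proof -
    have "norm (?tl m) \<le> exp (exp 1 * norm (w - 1) * m - D)"
      by (rule norm_binomial_tail_le)
    also have "\<dots> \<le> ?B" using that by (simp add: mult_left_mono)
    finally show ?thesis .
  qed
  hence tail: "norm (\<Sum>m\<in>T. ?tl m) \<le> card T * ?B" if "T \<subseteq> {..H}" for T
    using that by (intro sum_norm_bound) auto
  have head_plus_tail: "(\<Sum>m\<in>T. w ^ m) = (\<Sum>m\<in>T. ?hd m) + (\<Sum>m\<in>T. ?tl m)" for T
    unfolding sum.distrib[symmetric] by (intro sum.cong refl power_eq_binomial_head_plus_tail)
  have "(\<Sum>m\<in>S. w ^ m) - (\<Sum>m\<in>S'. w ^ m) = (\<Sum>m\<in>S. ?tl m) - (\<Sum>m\<in>S'. ?tl m)"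
    by (simp only: head_plus_tail head_eq add_diff_cancel_left)
  also have "norm \<dots> \<le> norm (\<Sum>m\<in>S. ?tl m) + norm (\<Sum>m\<in>S'. ?tl m)"
    by (rule norm_triangle_ineq4)
  also have "\<dots> \<le> card S * ?B + card S' * ?B"
    by (intro add_mono tail S)
  finally show ?thesis by (simp add: distrib_right)
qed

section \<open>Sparse strings with nearly equal one-bit statistics\<close>

lemma norm_deletion_map_le:
  fixes z :: complex
  assumes \<delta>: "0 \<le> \<delta>" "\<delta> < 1" and z: "norm z = 1"
  defines "w \<equiv> deletion_map \<delta> z"
  shows "norm w \<le> exp (- (\<delta> / (2 * (1 - \<delta>)) * (norm (w - 1))\<^sup>2))"
proof -
  have on_circle: "(Re z)\<^sup>2 + (Im z)\<^sup>2 = 1" using z by (simp add: cmod_def)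
  have "(norm (w - 1))\<^sup>2 = (1 - \<delta>)\<^sup>2 * (2 - 2 * Re z)"
    using on_circle unfolding cmod_power2 w_def deletion_map_def
    by (simp add: power2_eq_square) algebra
  moreover have "(norm w)\<^sup>2 = 1 - \<delta> * (1 - \<delta>) * (2 - 2 * Re z)"
    using on_circle unfolding cmod_power2 w_def deletion_map_def
    by (simp add: power2_eq_square) algebra
  ultimately have "(1 - \<delta>) * (norm w)\<^sup>2 = (1 - \<delta>) - \<delta> * (norm (w - 1))\<^sup>2"
    by algebra
  hence "(norm w)\<^sup>2 = 1 + (- (\<delta> / (1 - \<delta>) * (norm (w - 1))\<^sup>2))"
    using \<delta> by (simp add: field_simps)
  also have "\<dots> \<le> exp (- (\<delta> / (1 - \<delta>) * (norm (w - 1))\<^sup>2))" by (rule exp_ge_add_one_self)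
  also have "\<dots> = (exp (- (\<delta> / (2 * (1 - \<delta>)) * (norm (w - 1))\<^sup>2)))\<^sup>2"
    using \<delta> by (simp add: divide_simps flip: exp_double)
  finally show ?thesis by (rule power2_le_imp_le) simp
qed

lemma bit_prob_diff_le_sup_circle:
  assumes \<delta>: "0 \<le> \<delta>" "\<delta> \<le> 1" and len: "length x = length x'"
    and bound: "\<And>z. norm z = 1 \<Longrightarrow>
      norm (horner_sum of_bool (deletion_map \<delta> z) x -
            horner_sum of_bool (deletion_map \<delta> z) x') \<le> B"
  shows "\<bar>bit_prob \<delta> x j - bit_prob \<delta> x' j\<bar> \<le> (1 - \<delta>) * B"
proof -
  define d where "d j = complex_of_real (bit_prob \<delta> x j - bit_prob \<delta> x' j)" for j
  define p where "p = (\<Sum>j<length x. monom (d j) j)"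
  have "norm (poly p z) \<le> (1 - \<delta>) * B" if "norm z = 1" for z
  proof -
    let ?w = "deletion_map \<delta> z"
    have "poly p z = (\<Sum>j<length x. of_real (bit_prob \<delta> x j) * z ^ j) -
        (\<Sum>j<length x'. of_real (bit_prob \<delta> x' j) * z ^ j)"
      by (simp add: p_def d_def poly_sum poly_monom len sum_subtractf left_diff_distrib)
    also have "\<dots> = of_real (1 - \<delta>) * (horner_sum of_bool ?w x - horner_sum of_bool ?w x')"
      using \<delta> by (simp only: sum_bit_prob_eq_horner_sum right_diff_distrib)
    also have "norm \<dots> = (1 - \<delta>) * norm (horner_sum of_bool ?w x - horner_sum of_bool ?w x')"
      using \<delta> by (simp add: norm_mult del: of_real_diff)
    also have "\<dots> \<le> (1 - \<delta>) * B"
      using \<delta> bound[OF that] by (intro mult_left_mono) auto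
    finally show ?thesis .
  qed
  hence "norm (coeff p j) \<le> (1 - \<delta>) * B"
    using norm_coeff_le_sup_circle[of 1 p "(1 - \<delta>) * B" j] by simp
  moreover have "coeff p j = d j"
    by (auto simp: p_def d_def coeff_sum bit_prob_eq_0 len)
  ultimately show ?thesis
    by (simp add: d_def del: of_real_diff)
qed

definition indicator_string :: "nat \<Rightarrow> nat set \<Rightarrow> bool list" where
  "indicator_string n S = map (\<lambda>m. m \<in> S) [0..<n]"

lemma length_indicator_string [simp]: "length (indicator_string n S) = n"
  by (simp add: indicator_string_def)

lemma bit_at_indicator_string: "bit_at (indicator_string n S) j \<longleftrightarrow> j < n \<and> j \<in> S"
  by (auto simp: indicator_string_def nth_default_def)

lemma inj_on_indicator_string: "inj_on (indicator_string n) (Pow {..<n})"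
proof (rule inj_onI)
  fix S S' assume sub: "S \<in> Pow {..<n}" "S' \<in> Pow {..<n}"
    and eq: "indicator_string n S = indicator_string n S'"
  have "j \<in> S \<longleftrightarrow> j \<in> S'" if "j < n" for j
    using eq that by (metis bit_at_indicator_string)
  thus "S = S'" using sub by blast
qed

lemma spaced_indicator_string:
  assumes "S \<subseteq> range (\<lambda>t. s + Suc g * t)"
  shows "spaced g (indicator_string n S)"
  unfolding spaced_def bit_at_indicator_string
proof (intro allI impI, elim conjE)
  fix i j assume ij: "i < j" "i \<in> S" "j \<in> S"
  then obtain a b where ab: "i = s + Suc g * a" "j = s + Suc g * b" using assms by blast
  hence "a < b" using ij by (simp del: mult_Suc)
  hence "Suc g * (a + 1) \<le> Suc g * b" by (intro mult_le_mono2) simp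
  thus "i + g < j" using ab by simp
qed

lemma horner_sum_indicator_string:
  fixes w :: "'a :: comm_semiring_1"
  assumes "S \<subseteq> {..<n}"
  shows "horner_sum of_bool w (indicator_string n S) = (\<Sum>m\<in>S. w ^ m)"
proof -
  have "horner_sum of_bool w (indicator_string n S) = (\<Sum>m<n. of_bool (m \<in> S) * w ^ m)"
    using assms by (simp add: horner_sum_of_bool_eq_sum_bit_at[of _ n] bit_at_indicator_string)
  also have "\<dots> = (\<Sum>m\<in>S. w ^ m)"
    using assms by (intro sum.mono_neutral_cong_right) auto
  finally show ?thesis .
qed

lemma linear_minus_quadratic_le:
  fixes c d k t :: real
  assumes "k > 0" "c\<^sup>2 \<le> 4 * k * d"
  shows "c * t - k * t\<^sup>2 \<le> d"
proof -
  have "0 \<le> (c - 2 * k * t)\<^sup>2" by simp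
  hence "4 * k * (c * t - k * t\<^sup>2) \<le> c\<^sup>2"
    by (simp add: power2_eq_square algebra_simps)
  also note assms(2)
  finally show ?thesis using \<open>k > 0\<close> by simp
qed

lemma norm_shifted_power_sum_diff_le:
  fixes z :: complex
  assumes \<delta>: "0 < \<delta>" "\<delta> < 1" and z: "norm z = 1" and "0 < s"
    and T: "T \<subseteq> {..H}" "T' \<subseteq> {..H}" "same_binomial_moments D T T'"
    and small: "(exp 1)\<^sup>2 * (1 - \<delta>) * (real H)\<^sup>2 \<le> \<delta> * real s * real D"
  defines "w \<equiv> deletion_map \<delta> z"
  shows "norm ((\<Sum>m\<in>(+) s ` T. w ^ m) - (\<Sum>m\<in>(+) s ` T'. w ^ m)) \<le>
    (card T + card T') * exp (- (real D / 2))"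
proof -
  define k where "k = \<delta> / (2 * (1 - \<delta>)) * s"
  have shift: "(\<Sum>m\<in>(+) s ` U. w ^ m) = w ^ s * (\<Sum>t\<in>U. w ^ t)" for U
    by (subst sum.reindex) (auto simp: power_add sum_distrib_left)
  have "norm w ^ s \<le> exp (- (\<delta> / (2 * (1 - \<delta>)) * (norm (w - 1))\<^sup>2)) ^ s"
    unfolding w_def using \<delta> z by (intro power_mono norm_deletion_map_le) auto
  also have "\<dots> = exp (- (k * (norm (w - 1))\<^sup>2))"
    by (simp add: k_def mult_ac flip: exp_of_nat_mult)
  finally have decay: "norm w ^ s \<le> exp (- (k * (norm (w - 1))\<^sup>2))" .
  have "norm ((\<Sum>m\<in>(+) s ` T. w ^ m) - (\<Sum>m\<in>(+) s ` T'. w ^ m)) =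
      norm w ^ s * norm ((\<Sum>t\<in>T. w ^ t) - (\<Sum>t\<in>T'. w ^ t))"
    by (simp only: shift norm_mult norm_power flip: right_diff_distrib)
  also have "\<dots> \<le> exp (- (k * (norm (w - 1))\<^sup>2)) *
      ((card T + card T') * exp (exp 1 * norm (w - 1) * H - D))"
    by (intro mult_mono decay norm_power_sum_diff_le T) auto
  also have "\<dots> = (card T + card T') * exp (exp 1 * H * norm (w - 1) - k * (norm (w - 1))\<^sup>2 - D)"
    by (simp add: mult_ac flip: exp_add)
  also have "\<dots> \<le> (card T + card T') * exp (- (real D / 2))"
  proof -
    have "k > 0" using \<delta> \<open>0 < s\<close> by (simp add: k_def)
    moreover have "(exp 1 * H)\<^sup>2 \<le> 4 * k * (D / 2)"
      using small \<delta> by (simp add: k_def field_simps power_mult_distrib)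
    ultimately have "exp 1 * H * norm (w - 1) - k * (norm (w - 1))\<^sup>2 \<le> D / 2"
      by (rule linear_minus_quadratic_le)
    thus ?thesis by (intro mult_left_mono) auto
  qed
  finally show ?thesis .
qed

lemma bit_prob_shifted_indicator_string_diff_le:
  assumes \<delta>: "0 < \<delta>" "\<delta> < 1" and s: "0 < s" "s + H \<le> n"
    and T: "T \<subseteq> {..<H}" "T' \<subseteq> {..<H}" "same_binomial_moments D T T'"
    and small: "(exp 1)\<^sup>2 * (1 - \<delta>) * (real H)\<^sup>2 \<le> \<delta> * real s * real D"
  defines "x \<equiv> \<lambda>U. indicator_string n ((+) s ` U)"
  shows "\<bar>bit_prob \<delta> (x T) j - bit_prob \<delta> (x T') j\<bar> \<le>
    (1 - \<delta>) * ((card T + card T') * exp (- (real D / 2)))"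
proof (rule bit_prob_diff_le_sup_circle)
  fix z :: complex assume z: "norm z = 1"
  have "T \<subseteq> {..H}" "T' \<subseteq> {..H}" using T by auto
  note bound = norm_shifted_power_sum_diff_le[OF \<delta> z s(1) this T(3) small]
  have "(+) s ` T \<subseteq> {..<n}" "(+) s ` T' \<subseteq> {..<n}" using T s by fastforce+
  thus "norm (horner_sum of_bool (deletion_map \<delta> z) (x T) -
      horner_sum of_bool (deletion_map \<delta> z) (x T')) \<le> (card T + card T') * exp (- (real D / 2))"
    using bound by (simp only: x_def horner_sum_indicator_string)
qed (use \<delta> in \<open>auto simp: x_def\<close>)

lemma spaced_pair_with_close_bit_probs_exists:
  assumes \<delta>: "0 < \<delta>" "\<delta> < 1" and pigeons: "n ^ (D * D) < 2 ^ N"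
    and s: "0 < s" "s + Suc g * N \<le> n"
    and small: "(exp 1)\<^sup>2 * (1 - \<delta>) * (real (Suc g * N))\<^sup>2 \<le> \<delta> * real s * real D"
  obtains x x' where "length x = n" "length x' = n" "x \<noteq> x'" "spaced g x" "spaced g x'"
    "\<And>j. \<bar>bit_prob \<delta> x j - bit_prob \<delta> x' j\<bar> \<le> 2 * real N * exp (- (real D / 2))"
proof -
  define P where "P = (*) (Suc g) ` {..<N}"
  have P: "finite P" "card P = N" "P \<subseteq> {..<Suc g * N}"
    by (auto simp: P_def card_image inj_on_def simp del: mult_Suc)
  have "P \<subseteq> {..n}" "card P < n" using P s by auto
  then obtain T T' where T: "T \<subseteq> P" "T' \<subseteq> P" "T \<noteq> T'" "same_binomial_moments D T T'"
    using pigeons P(2) by (metis same_binomial_moments_exist)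
  let ?x = "\<lambda>U. indicator_string n ((+) s ` U)"
  show thesis
  proof (rule that[of "?x T" "?x T'"])
    have "(+) s ` U \<in> Pow {..<n}" if "U \<subseteq> P" for U
      using that P(3) s(2) by fastforce
    thus "?x T \<noteq> ?x T'"
      using T by (simp add: inj_on_eq_iff[OF inj_on_indicator_string] inj_image_eq_iff)
    have "spaced g (?x U)" if "U \<subseteq> P" for U
      by (rule spaced_indicator_string[of _ s]) (use that in \<open>auto simp: P_def simp del: mult_Suc\<close>)
    thus "spaced g (?x T)" "spaced g (?x T')" using T by auto
    show "\<bar>bit_prob \<delta> (?x T) j - bit_prob \<delta> (?x T') j\<bar> \<le> 2 * real N * exp (- (real D / 2))" for j
    proof -
      have T_less: "T \<subseteq> {..<Suc g * N}" "T' \<subseteq> {..<Suc g * N}" using T P(3) by auto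
      have card_le: "card T \<le> N" "card T' \<le> N" using T P card_mono by metis+
      have "\<bar>bit_prob \<delta> (?x T) j - bit_prob \<delta> (?x T') j\<bar> \<le>
          (1 - \<delta>) * ((card T + card T') * exp (- (real D / 2)))"
        using \<delta> s T_less T(4) small by (rule bit_prob_shifted_indicator_string_diff_le)
      also have "\<dots> \<le> 1 * (2 * real N * exp (- (real D / 2)))"
        using \<delta> card_le by (intro mult_mono) auto
      finally show ?thesis by simp
    qed
  qed simp_all
qed

section \<open>Choice of parameters\<close>

definition admissible :: "real \<Rightarrow> real \<Rightarrow> real \<Rightarrow> nat \<Rightarrow> nat \<Rightarrow> nat \<Rightarrow> nat \<Rightarrow> nat \<Rightarrow> bool" where
  "admissible \<delta> a \<Lambda> n g D N s \<longleftrightarrow>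
     4 * \<Lambda> / (1 - \<delta>) \<le> g \<and> a * \<Lambda> \<le> D \<and> n ^ (D * D) < 2 ^ N \<and> 0 < s \<and> s + Suc g * N \<le> n \<and>
     (exp 1)\<^sup>2 * (1 - \<delta>) * (real (Suc g * N))\<^sup>2 \<le> \<delta> * real s * real D"

lemma two_power_mult_decay_le_exp:
  assumes \<delta>: "0 \<le> \<delta>" "\<delta> < 1" and l: "real l \<le> \<Lambda>" and g: "4 * \<Lambda> / (1 - \<delta>) \<le> real g"
  shows "2 ^ l * ((1 + \<delta>) / 2) ^ g \<le> exp (- \<Lambda>)"
proof -
  have "(2 :: real) ^ l \<le> exp 1 ^ l"
    using exp_ge_add_one_self[of 1] by (intro power_mono) auto
  also have "\<dots> \<le> exp \<Lambda>" using l by (simp flip: exp_of_nat_mult)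
  finally have growth: "2 ^ l \<le> exp \<Lambda>" .
  have "(1 + \<delta>) / 2 = 1 + (- ((1 - \<delta>) / 2))" by (simp add: field_simps)
  also have "\<dots> \<le> exp (- ((1 - \<delta>) / 2))" by (rule exp_ge_add_one_self)
  finally have "((1 + \<delta>) / 2) ^ g \<le> exp (- ((1 - \<delta>) / 2)) ^ g"
    using \<delta> by (intro power_mono) auto
  also have "\<dots> = exp (- ((1 - \<delta>) / 2 * g))" by (simp flip: exp_of_nat_mult add: mult.commute)
  also have "\<dots> \<le> exp (- (2 * \<Lambda>))" using g \<delta> by (simp add: field_simps)
  finally have decay: "((1 + \<delta>) / 2) ^ g \<le> exp (- (2 * \<Lambda>))" .
  have "2 ^ l * ((1 + \<delta>) / 2) ^ g \<le> exp \<Lambda> * exp (- (2 * \<Lambda>))"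
    using \<delta> by (intro mult_mono growth decay) auto
  thus ?thesis by (simp flip: exp_add)
qed

lemma trace_prob_crowded_le_exp:
  assumes \<delta>: "0 \<le> \<delta>" "\<delta> < 1" and "spaced g x"
    and "real l \<le> \<Lambda>" "4 * \<Lambda> / (1 - \<delta>) \<le> real g"
  shows "trace_prob \<delta> x (crowded l) \<le> length x * exp (- \<Lambda>)"
proof -
  have "trace_prob \<delta> x (crowded l) \<le> length x * (2 ^ l * ((1 + \<delta>) / 2) ^ g)"
    using assms by (intro trace_prob_crowded_le) auto
  also have "\<dots> \<le> length x * exp (- \<Lambda>)"
    using assms by (intro mult_left_mono two_power_mult_decay_le_exp) auto
  finally show ?thesis .
qed

lemma admissible_imp_indistinguishable_pair:
  assumes \<delta>: "0 < \<delta>" "\<delta> < 1" and a: "a \<le> 1" and \<Lambda>: "0 \<le> \<Lambda>"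
    and admissible: "admissible \<delta> a \<Lambda> n g D N s"
    and error: "(2 + 4 * \<Lambda>) * n * exp (- (a * \<Lambda> / 2)) \<le> \<tau>"
  shows "admits_indistinguishable_pair \<delta> \<Lambda> \<tau> n"
proof -
  note params = admissible[unfolded admissible_def]
  obtain x x' where x: "length x = n" "length x' = n" "x \<noteq> x'" "spaced g x" "spaced g x'"
    and bits: "\<And>j. \<bar>bit_prob \<delta> x j - bit_prob \<delta> x' j\<bar> \<le> 2 * real N * exp (- (real D / 2))"
    using spaced_pair_with_close_bit_probs_exists[OF \<delta>, of n D N s g] params by blast
  define E where "E = exp (- (a * \<Lambda> / 2))"
  have "a * \<Lambda> \<le> \<Lambda>" using mult_right_mono[OF a \<Lambda>] by simp
  hence decay: "exp (- \<Lambda>) \<le> E" using \<Lambda> by (simp add: E_def)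
  have crowd: "trace_prob \<delta> u (crowded l) \<le> n * E"
    if "length u = n" "spaced g u" "real l \<le> \<Lambda>" for u l
  proof -
    have "trace_prob \<delta> u (crowded l) \<le> n * exp (- \<Lambda>)"
      using trace_prob_crowded_le_exp[of \<delta> g u l \<Lambda>] that \<delta> params by simp
    also have "\<dots> \<le> n * E" using decay by (intro mult_left_mono) auto
    finally show ?thesis .
  qed
  have "N \<le> Suc g * N" by simp
  hence "N \<le> n" using params by linarith
  hence "2 * real N * exp (- (real D / 2)) \<le> 2 * n * E"
    using params by (intro mult_mono) (auto simp: E_def)
  hence bits_E: "\<bar>bit_prob \<delta> x j - bit_prob \<delta> x' j\<bar> \<le> 2 * n * E" for j
    using bits[of j] by linarith
  have "indistinguishable \<delta> n l \<tau> x x'" if l: "real l \<le> \<Lambda>" for l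
  proof (rule indistinguishable_mono)
    show "indistinguishable \<delta> n l (2 * (1 + real l) * (n * E) + real l * (2 * n * E)) x x'"
      using x l by (intro indistinguishable_if_bit_probs_close crowd bits_E)
    have "2 * (1 + real l) * (n * E) + real l * (2 * n * E) = (2 + 4 * real l) * n * E"
      by (simp add: algebra_simps)
    also have "\<dots> \<le> (2 + 4 * \<Lambda>) * n * E"
      using l by (intro mult_right_mono) (auto simp: E_def)
    also have "\<dots> \<le> \<tau>" using error by (simp add: E_def)
    finally show "2 * (1 + real l) * (n * E) + real l * (2 * n * E) \<le> \<tau>" .
  qed
  with x(1-3) show ?thesis unfolding admits_indistinguishable_pair_def by blast
qed

lemma ex_nat_greater_le_add_one:
  fixes u :: real
  assumes "0 \<le> u"
  obtains k :: nat where "u < k" "k \<le> u + 1"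
proof
  show "u < Suc (nat \<lfloor>u\<rfloor>)" "Suc (nat \<lfloor>u\<rfloor>) \<le> u + 1" using assms by linarith+
qed

lemma square_mult_add_one_le:
  fixes d u L :: real
  assumes "0 \<le> d" "d \<le> 2 * u" "1 \<le> u" "1 \<le> L"
  shows "d\<^sup>2 * L + 1 \<le> 5 * u\<^sup>2 * L"
proof -
  have "d\<^sup>2 \<le> (2 * u)\<^sup>2" using assms by (intro power_mono) auto
  hence "d\<^sup>2 * L \<le> 4 * u\<^sup>2 * L"
    using assms by (intro mult_right_mono) (auto simp: power_mult_distrib)
  moreover have "1 * 1 \<le> u\<^sup>2 * L"
    using assms by (intro mult_mono one_le_power) auto
  ultimately show ?thesis by simp
qed

lemma power_less_two_power_if_log_less:
  fixes n k N :: nat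
  assumes "0 < n" "k * log 2 n < N"
  shows "n ^ k < 2 ^ N"
proof -
  have "real (n ^ k) = 2 powr (log 2 n * k)"
    using assms(1) by (simp add: powr_realpow flip: powr_powr)
  also have "\<dots> < 2 powr N" using assms(2) by (simp add: mult.commute)
  finally have "real (n ^ k) < real (2 ^ N)" by (simp add: powr_realpow)
  thus ?thesis unfolding of_nat_less_iff .
qed

text \<open>
  The square of the bound on \<open>H\<close> is \<open>625 a\<^sup>4 \<Lambda> n / p\<^sup>2\<close>, so with \<open>exp 1 \<le> 3\<close> the claim reduces to
  \<open>3 * 9 * 625 * a\<^sup>3 \<le> \<delta> p\<close>; this is where \<open>16875\<close> comes from.
\<close>

lemma admissible_square_le:
  fixes \<delta> p a \<Lambda> L n s D H :: real
  assumes nonneg: "0 \<le> \<delta>" "0 < p" "0 < a" "0 \<le> \<Lambda>" "0 \<le> n" "0 \<le> H"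
    and a: "16875 * a ^ 3 \<le> \<delta> * p" and n: "\<Lambda> ^ 5 * L\<^sup>2 = n"
    and H: "H \<le> 25 * a\<^sup>2 * \<Lambda> ^ 3 * L / p" and s: "n / 3 \<le> s" and D: "a * \<Lambda> \<le> D"
  shows "(exp 1)\<^sup>2 * p * H\<^sup>2 \<le> \<delta> * s * D"
proof -
  have "(exp 1)\<^sup>2 * p * H\<^sup>2 \<le> 3\<^sup>2 * p * (25 * a\<^sup>2 * \<Lambda> ^ 3 * L / p)\<^sup>2"
    using nonneg H exp_le by (intro mult_mono power_mono) auto
  also have "\<dots> = 5625 * a ^ 4 * \<Lambda> * (\<Lambda> ^ 5 * L\<^sup>2) / p"
    using nonneg by (simp add: field_simps eval_nat_numeral)
  also have "\<dots> = 16875 * a ^ 3 * (a * \<Lambda> * (n / 3)) / p"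
    unfolding n by (simp add: eval_nat_numeral)
  also have "\<dots> \<le> \<delta> * p * (a * \<Lambda> * (n / 3)) / p"
    using a nonneg by (intro divide_right_mono mult_right_mono) auto
  also have "\<dots> = \<delta> * (n / 3) * (a * \<Lambda>)" using nonneg by simp
  also have "\<dots> \<le> \<delta> * s * D"
    using nonneg s D by (intro mult_mono) auto
  finally show ?thesis .
qed

lemma admissible_exist:
  fixes n :: nat and \<delta> a \<Lambda> :: real
  defines "p \<equiv> 1 - \<delta>" and "L \<equiv> log 2 n"
  assumes \<delta>: "0 < \<delta>" "\<delta> < 1" and a: "0 < a" "16875 * a ^ 3 \<le> \<delta> * p"
    and n: "2 \<le> n" "\<Lambda> ^ 5 * L\<^sup>2 = n" and \<Lambda>: "2 \<le> \<Lambda>" "1 \<le> a * \<Lambda>"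
    and room: "25 * a\<^sup>2 * \<Lambda> ^ 3 * L / p \<le> n / 2"
  obtains g D N s where "admissible \<delta> a \<Lambda> n g D N s"
proof -
  have p: "0 < p" "p \<le> 1" using \<delta> by (auto simp: p_def)
  have L: "1 \<le> L" using n by (simp add: L_def le_log_iff)
  obtain g :: nat where g: "4 * \<Lambda> / p < g" "g \<le> 4 * \<Lambda> / p + 1"
    using \<Lambda> p ex_nat_greater_le_add_one[of "4 * \<Lambda> / p"] by auto
  obtain D :: nat where D: "a * \<Lambda> < D" "D \<le> a * \<Lambda> + 1"
    using \<Lambda> ex_nat_greater_le_add_one[of "a * \<Lambda>"] by auto
  obtain N :: nat where N: "real (D * D) * L < N" "N \<le> real (D * D) * L + 1"
    using L ex_nat_greater_le_add_one[of "real (D * D) * L"] by auto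
  define s where "s = n div 2"
  have "n \<le> 3 * s" using n(1) unfolding s_def by linarith
  hence s: "n / 3 \<le> real s" "0 < s" "real s \<le> n / 2" using n(1) by (auto simp: s_def)
  have "2 \<le> \<Lambda> / p" using \<Lambda> p by (simp add: field_simps)
  hence Suc_g: "Suc g \<le> 5 * \<Lambda> / p" using g by simp
  have "(real D)\<^sup>2 * L + 1 \<le> 5 * (a * \<Lambda>)\<^sup>2 * L"
    using D \<Lambda> L by (intro square_mult_add_one_le) auto
  hence N_le: "N \<le> 5 * (a * \<Lambda>)\<^sup>2 * L" using N(2) by (simp add: power2_eq_square)
  define H where "H = Suc g * N"
  have "real H \<le> (5 * \<Lambda> / p) * (5 * (a * \<Lambda>)\<^sup>2 * L)"
    unfolding H_def of_nat_mult using Suc_g N_le \<Lambda> p by (intro mult_mono) auto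
  also have "\<dots> = 25 * a\<^sup>2 * \<Lambda> ^ 3 * L / p"
    by (simp add: field_simps eval_nat_numeral)
  finally have H_le: "real H \<le> 25 * a\<^sup>2 * \<Lambda> ^ 3 * L / p" .
  have small: "(exp 1)\<^sup>2 * p * (real H)\<^sup>2 \<le> \<delta> * real s * real D"
    using \<delta> p a n(2) \<Lambda> s D H_le by (intro admissible_square_le[of \<delta> p a \<Lambda> n _ L]) auto
  have "real (s + H) \<le> n" using s(3) H_le room by simp
  hence "s + H \<le> n" by simp
  moreover have "n ^ (D * D) < 2 ^ N"
    using n N(1) by (intro power_less_two_power_if_log_less) (auto simp: L_def)
  ultimately have "admissible \<delta> a \<Lambda> n g D N s"
    using g(1) D(1) s(2) small unfolding admissible_def p_def H_def by simp
  thus thesis by (rule that)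
qed

definition sq_exponent :: "nat \<Rightarrow> real" where
  "sq_exponent n = real n powr (1/5) / log 2 (real n) powr (2/5)"

lemma sq_exponent_power_mult:
  assumes "2 \<le> n"
  shows "sq_exponent n ^ 5 * (log 2 n)\<^sup>2 = n"
proof -
  have "log 2 n > 0" using assms by simp
  hence "(log 2 n powr (2/5)) ^ 5 = (log 2 n)\<^sup>2"
    by (simp add: powr_power)
  moreover have "(real n powr (1/5)) ^ 5 = n"
    using assms by (simp add: powr_power)
  ultimately show ?thesis
    using \<open>log 2 n > 0\<close> by (simp add: sq_exponent_def power_divide)
qed

lemma eventually_admissible_exist:
  assumes \<delta>: "0 < \<delta>" "\<delta> < 1" and a: "0 < a" "16875 * a ^ 3 \<le> \<delta> * (1 - \<delta>)"
  shows "\<forall>\<^sub>F n in sequentially. \<exists>g D N s. admissible \<delta> a (sq_exponent n) n g D N s"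
proof -
  have "\<forall>\<^sub>F n in sequentially. 2 \<le> sq_exponent n"
    unfolding sq_exponent_def by real_asymp
  moreover have "\<forall>\<^sub>F n in sequentially. 1 \<le> a * sq_exponent n"
    unfolding sq_exponent_def using a by real_asymp
  moreover have "\<forall>\<^sub>F n in sequentially. 25 * a\<^sup>2 * sq_exponent n ^ 3 * log 2 n / (1 - \<delta>) \<le> n / 2"
  proof -
    have "0 < 25 * a\<^sup>2 / (1 - \<delta>)" using \<delta> a by simp
    hence "\<forall>\<^sub>F n in sequentially. 25 * a\<^sup>2 / (1 - \<delta>) * sq_exponent n ^ 3 * log 2 n \<le> n / 2"
      unfolding sq_exponent_def by real_asymp
    thus ?thesis by simp
  qed
  ultimately show ?thesis
    using eventually_ge_at_top[of 2]
  proof eventually_elim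
    case (elim n)
    obtain g D N s where "admissible \<delta> a (sq_exponent n) n g D N s"
      using admissible_exist[OF \<delta> a elim(4) sq_exponent_power_mult[OF elim(4)] elim(1-3)] .
    thus ?case by blast
  qed
qed

lemma eventually_admits_indistinguishable_pair:
  assumes \<delta>: "0 < \<delta>" "\<delta> < 1"
  obtains c where "c > 0"
    "\<forall>\<^sub>F n in sequentially.
      admits_indistinguishable_pair \<delta> (sq_exponent n) (exp (- (c * sq_exponent n))) n"
proof -
  define a where "a = \<delta> * (1 - \<delta>) / 16875"
  have "0 < \<delta> * (1 - \<delta>)" "\<delta> * (1 - \<delta>) \<le> 1" using \<delta> by (auto simp: mult_le_one)
  hence a: "0 < a" "a \<le> 1" by (auto simp: a_def)
  have "a ^ 3 \<le> a ^ 1" using a by (intro power_decreasing) auto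
  hence a_cubed: "16875 * a ^ 3 \<le> \<delta> * (1 - \<delta>)" by (simp add: a_def)
  have "\<forall>\<^sub>F n in sequentially. 0 \<le> sq_exponent n"
    unfolding sq_exponent_def by real_asymp
  moreover have "\<forall>\<^sub>F n in sequentially.
      (2 + 4 * sq_exponent n) * n * exp (- (a * sq_exponent n / 2)) \<le> exp (- (a / 4 * sq_exponent n))"
    unfolding sq_exponent_def using a by real_asymp
  ultimately have "\<forall>\<^sub>F n in sequentially.
      admits_indistinguishable_pair \<delta> (sq_exponent n) (exp (- (a / 4 * sq_exponent n))) n"
    using eventually_admissible_exist[OF \<delta> a(1) a_cubed]
    by eventually_elim (use admissible_imp_indistinguishable_pair[OF \<delta> a(2)] in blast)
  with a show thesis by (intro that[of "a / 4"]) auto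
qed

theorem theorem3p1:
  "\<exists>c\<^sub>0>0. \<forall>\<delta>::real. 0 < \<delta> \<and> \<delta> < 1 \<longrightarrow>
     (\<exists>c>0. \<forall>\<^sub>F n in sequentially. \<forall>(l::nat) (\<tau>\<^sub>0::real) A.
        real l \<le> c\<^sub>0 * (real n powr (1/5) / log 2 (real n) powr (2/5)) \<longrightarrow>
        local_sq_algorithm n l \<tau>\<^sub>0 A \<longrightarrow>
        solves_trace_reconstruction \<delta> n A \<longrightarrow>
        \<tau>\<^sub>0 < exp (- (c * (real n powr (1/5) / log 2 (real n) powr (2/5)))))"
proof (rule exI[of _ 1], intro conjI allI impI, goal_cases)
  case (2 \<delta>)
  then obtain c where "c > 0"
    and "\<forall>\<^sub>F n in sequentially.
      admits_indistinguishable_pair \<delta> (sq_exponent n) (exp (- (c * sq_exponent n))) n"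
    using eventually_admits_indistinguishable_pair by blast
  from this(2) have "\<forall>\<^sub>F n in sequentially. \<forall>(l::nat) (\<tau>\<^sub>0::real) A. real l \<le> 1 * sq_exponent n \<longrightarrow>
      local_sq_algorithm n l \<tau>\<^sub>0 A \<longrightarrow> solves_trace_reconstruction \<delta> n A \<longrightarrow>
      \<tau>\<^sub>0 < exp (- (c * sq_exponent n))"
    by eventually_elim (simp, blast intro: tolerance_less_if_solves)
  with \<open>c > 0\<close> show ?case unfolding sq_exponent_def by blast
qed simp

end
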